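(* Let $R$ be a ring and let $M$ be an object of $\mathrm{Morph}(\mathrm{Mod}\text{-}R)$, that is, a homomorphism $\mu_M\colon M_0\to M_1$ of right $R$-modules. If $\mathrm{End}_R(M_0)$ and $\mathrm{End}_R(M_1)$ are semilocal rings, then the endomorphism ring $E_M$ of $M$ in the category $\mathrm{Morph}(\mathrm{Mod}\text{-}R)$ is semilocal.
   Context: Rings are associative with identity $1\neq 0$. $\mathrm{Morph}(\mathrm{Mod}\text{-}R)$ is the category whose objects are the right $R$-module homomorphisms; an object $M$ is a homomorphism $\mu_M\colon M_0\to M_1$. A morphism $u\colon M\to N$ is a pair $(u_0,u_1)$ of right $R$-module homomorphisms $u_0\colon M_0\to N_0$, $u_1\colon M_1\to N_1$ with $u_1\mu_M=\mu_N u_0$; composition and addition are componentwise. $E_M$ denotes the endomorphism ring of $M$ in this category, i.e. the set of all $(u_0,u_1)\in \mathrm{End}_R(M_0)\times\mathrm{End}_R(M_1)$ with $u_1\mu_M=\mu_M u_0$, with componentwise operations. A ring $S$ is semilocal if $S/J(S)$ is semisimple artinian, where $J(S)$ is the Jacobson radical of $S$. *)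

theory Defs
  imports "HOL-Algebra.Algebra"
begin

section \<open>Right modules over a not necessarily commutative ring\<close>

text \<open>
  The library's \<open>module\<close> locale requires a commutative ring of scalars. The multiplicative fields
  inherited from the record type \<open>ring\<close> play no role here, exactly as in the library's
  record \<open>module\<close>.
\<close>

record ('a, 'b) rmodule = "'b ring" +
  rsmult :: "['b, 'a] \<Rightarrow> 'b" (infixl \<open>\<triangleleft>\<index>\<close> 70)

locale right_module = R?: ring R + M?: abelian_group M
  for R :: "('a, 'r) ring_scheme" (structure) and M :: "('a, 'b, 'm) rmodule_scheme" (structure) +
  assumes rsmult_closed:
      "\<lbrakk> x \<in> carrier M; a \<in> carrier R \<rbrakk> \<Longrightarrow> x \<triangleleft>\<^bsub>M\<^esub> a \<in> carrier M"
    and rsmult_l_distr: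
      "\<lbrakk> x \<in> carrier M; y \<in> carrier M; a \<in> carrier R \<rbrakk> \<Longrightarrow>
        (x \<oplus>\<^bsub>M\<^esub> y) \<triangleleft>\<^bsub>M\<^esub> a = x \<triangleleft>\<^bsub>M\<^esub> a \<oplus>\<^bsub>M\<^esub> y \<triangleleft>\<^bsub>M\<^esub> a"
    and rsmult_r_distr:
      "\<lbrakk> x \<in> carrier M; a \<in> carrier R; b \<in> carrier R \<rbrakk> \<Longrightarrow>
        x \<triangleleft>\<^bsub>M\<^esub> (a \<oplus>\<^bsub>R\<^esub> b) = x \<triangleleft>\<^bsub>M\<^esub> a \<oplus>\<^bsub>M\<^esub> x \<triangleleft>\<^bsub>M\<^esub> b"
    and rsmult_assoc:
      "\<lbrakk> x \<in> carrier M; a \<in> carrier R; b \<in> carrier R \<rbrakk> \<Longrightarrow>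
        (x \<triangleleft>\<^bsub>M\<^esub> a) \<triangleleft>\<^bsub>M\<^esub> b = x \<triangleleft>\<^bsub>M\<^esub> (a \<otimes>\<^bsub>R\<^esub> b)"
    and rsmult_one:
      "x \<in> carrier M \<Longrightarrow> x \<triangleleft>\<^bsub>M\<^esub> \<one>\<^bsub>R\<^esub> = x"

text \<open>Homomorphisms are extensional functions, so that each one has a unique representative.\<close>

definition rmod_hom ::
    "('a, 'r) ring_scheme \<Rightarrow> ('a, 'b, 'm) rmodule_scheme \<Rightarrow> ('a, 'c, 'n) rmodule_scheme \<Rightarrow> ('b \<Rightarrow> 'c) set"
  where "rmod_hom R M N =
    {f \<in> carrier M \<rightarrow>\<^sub>E carrier N.
      (\<forall>x\<in>carrier M. \<forall>y\<in>carrier M. f (x \<oplus>\<^bsub>M\<^esub> y) = f x \<oplus>\<^bsub>N\<^esub> f y) \<and>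
      (\<forall>x\<in>carrier M. \<forall>a\<in>carrier R. f (x \<triangleleft>\<^bsub>M\<^esub> a) = f x \<triangleleft>\<^bsub>N\<^esub> a)}"

definition rmod_End ::
    "('a, 'r) ring_scheme \<Rightarrow> ('a, 'b, 'm) rmodule_scheme \<Rightarrow> ('b \<Rightarrow> 'b) ring"
  where "rmod_End R M =
    \<lparr> carrier = rmod_hom R M M,
      monoid.mult = (\<lambda>f g. compose (carrier M) f g),
      one = (\<lambda>x\<in>carrier M. x),
      ring.zero = (\<lambda>x\<in>carrier M. \<zero>\<^bsub>M\<^esub>),
      ring.add = (\<lambda>f g. \<lambda>x\<in>carrier M. f x \<oplus>\<^bsub>M\<^esub> g x) \<rparr>"


section \<open>The category of module homomorphisms\<close>

record ('a, 'b, 'c) morph =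
  src :: "('a, 'b) rmodule"
  tgt :: "('a, 'c) rmodule"
  arr :: "'b \<Rightarrow> 'c"

definition morph_obj :: "('a, 'r) ring_scheme \<Rightarrow> ('a, 'b, 'c) morph \<Rightarrow> bool"
  where "morph_obj R M \<longleftrightarrow>
    right_module R (src M) \<and> right_module R (tgt M) \<and> arr M \<in> rmod_hom R (src M) (tgt M)"

definition morph_hom ::
    "('a, 'r) ring_scheme \<Rightarrow> ('a, 'b, 'c) morph \<Rightarrow> ('a, 'd, 'e) morph \<Rightarrow> (('b \<Rightarrow> 'd) \<times> ('c \<Rightarrow> 'e)) set"
  where "morph_hom R M N =
    {(u0, u1). u0 \<in> rmod_hom R (src M) (src N) \<and> u1 \<in> rmod_hom R (tgt M) (tgt N) \<and>
      compose (carrier (src M)) u1 (arr M) = compose (carrier (src M)) (arr N) u0}"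

text \<open>
  The constant \<open>RDirProd\<close> supplies the componentwise operations, zero and identity; only the
  carrier is cut down to the pairs that commute with the arrow.
\<close>

definition morph_End ::
    "('a, 'r) ring_scheme \<Rightarrow> ('a, 'b, 'c) morph \<Rightarrow> (('b \<Rightarrow> 'b) \<times> ('c \<Rightarrow> 'c)) ring"
  where "morph_End R M =
    (RDirProd (rmod_End R (src M)) (rmod_End R (tgt M))) \<lparr> carrier := morph_hom R M M \<rparr>"


section \<open>Semilocal rings\<close>

text \<open>The library's \<open>ideal\<close> and \<open>maximalideal\<close> are two-sided.\<close>

definition right_ideal :: "'a set \<Rightarrow> ('a, 'r) ring_scheme \<Rightarrow> bool"
  where "right_ideal I S \<longleftrightarrow>
    additive_subgroup I S \<and> (\<forall>x\<in>I. \<forall>a\<in>carrier S. x \<otimes>\<^bsub>S\<^esub> a \<in> I)"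

definition maximal_right_ideal :: "'a set \<Rightarrow> ('a, 'r) ring_scheme \<Rightarrow> bool"
  where "maximal_right_ideal I S \<longleftrightarrow>
    right_ideal I S \<and> I \<noteq> carrier S \<and>
    (\<forall>K. right_ideal K S \<and> I \<subseteq> K \<longrightarrow> K = I \<or> K = carrier S)"

definition minimal_right_ideal :: "'a set \<Rightarrow> ('a, 'r) ring_scheme \<Rightarrow> bool"
  where "minimal_right_ideal I S \<longleftrightarrow>
    right_ideal I S \<and> I \<noteq> {\<zero>\<^bsub>S\<^esub>} \<and>
    (\<forall>K. right_ideal K S \<and> K \<subseteq> I \<longrightarrow> K = {\<zero>\<^bsub>S\<^esub>} \<or> K = I)"

text \<open>The intersection with the carrier only matters for the zero ring, which has no maximal right ideals.\<close>

definition jacobson_radical :: "('a, 'r) ring_scheme \<Rightarrow> 'a set"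
  where "jacobson_radical S = carrier S \<inter> \<Inter>{I. maximal_right_ideal I S}"

text \<open>The sum of a family of right ideals is the smallest right ideal containing all of them.\<close>

definition right_ideal_sum :: "('a, 'r) ring_scheme \<Rightarrow> 'a set set \<Rightarrow> 'a set"
  where "right_ideal_sum S \<I> = \<Inter>{K. right_ideal K S \<and> \<Union>\<I> \<subseteq> K}"

text \<open>
  The regular right module is a sum of simple submodules and satisfies the descending chain
  condition. For semisimple artinian rings the choice of side is immaterial (Wedderburn--Artin).
  The zero ring is semisimple artinian, the sum being empty.
\<close>

definition semisimple_ring :: "('a, 'r) ring_scheme \<Rightarrow> bool"
  where "semisimple_ring S \<longleftrightarrow>
    ring S \<and> right_ideal_sum S {I. minimal_right_ideal I S} = carrier S"

definition artinian_ring :: "('a, 'r) ring_scheme \<Rightarrow> bool"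
  where "artinian_ring S \<longleftrightarrow>
    ring S \<and>
    (\<forall>I :: nat \<Rightarrow> 'a set. (\<forall>n. right_ideal (I n) S \<and> I (Suc n) \<subseteq> I n) \<longrightarrow>
      (\<exists>n. \<forall>m\<ge>n. I m = I n))"

definition semilocal_ring :: "('a, 'r) ring_scheme \<Rightarrow> bool"
  where "semilocal_ring S \<longleftrightarrow>
    ring S \<and>
    semisimple_ring (S Quot jacobson_radical S) \<and> artinian_ring (S Quot jacobson_radical S)"

end

theory Submission
  imports Defs
begin

text \<open>
  The argument is the one of Camps and Dicks for local homomorphisms into semilocal rings. The two
  projections from the endomorphism ring \<open>E\<close> of an arrow \<open>\<mu>\<close> to the endomorphism rings of its source
  and target jointly reflect units: if \<open>u\<^sub>1 \<mu> = \<mu> u\<^sub>0\<close> with both components invertible, then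
  \<open>u\<^sub>1\<^sup>-\<^sup>1 \<mu> = \<mu> u\<^sub>0\<^sup>-\<^sup>1\<close>. So it is enough that semilocality is pulled back along a pair of ring
  homomorphisms that jointly reflect units (\<open>semilocal_of_unit_reflecting_homs\<close>).

  What is pulled back is a rank. If \<open>S\<close> is semilocal and \<open>B = S/J(S)\<close>, attach to \<open>a \<in> S\<close> the right
  ideal \<open>aB\<close> generated by the class of \<open>a\<close>. Replacing \<open>a\<close> by \<open>a(1 - ba)\<close> keeps this right ideal if
  \<open>1 - ba\<close> is a unit, and strictly shrinks it otherwise: if \<open>a \<in> a(1 - ba)B\<close>, then \<open>1 - ba\<close> has a
  right inverse in \<open>B\<close>, hence an inverse because \<open>B\<close> is artinian, hence an inverse in \<open>S\<close>. By the
  descending chain condition the values are well-founded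
  (\<open>unit_rank_of_semilocal\<close>). Ranks of this kind on two rings combine lexicographically, and the
  result is a rank on any ring with jointly unit-reflecting homomorphisms to them.

  Conversely such a rank makes a ring \<open>A\<close> semilocal (\<open>semilocal_of_unit_rank\<close>). Given a right ideal
  \<open>I\<close>, choose \<open>a\<close> of minimal rank with \<open>1 - a \<in> I\<close>. Then \<open>I + aA = A\<close>. If \<open>ac \<in> I\<close>, then
  \<open>1 - a(1 - ca)\<close> lies in \<open>I\<close> too, so by minimality \<open>1 - ca\<close>, and with it \<open>1 - ac\<close>, is a unit; thus
  \<open>I \<inter> aA \<subseteq> J(A)\<close>, and \<open>aA\<close> is a complement of \<open>I\<close> modulo \<open>J(A)\<close>. Minimising over all right ideals
  of a given family at the same time shows moreover that one of them is maximal in the family. In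
  \<open>A/J(A)\<close> every right ideal therefore has a complement and the ascending chain condition holds, and
  passing to complements turns this into the descending chain condition (\<open>right_ideal_minimum\<close>),
  which in turn gives semisimplicity.
\<close>

section \<open>Right ideals and the Jacobson radical\<close>

definition principal_right_ideal :: "('a, 'r) ring_scheme \<Rightarrow> 'a \<Rightarrow> 'a set"
  where "principal_right_ideal S a = (\<lambda>x. a \<otimes>\<^bsub>S\<^esub> x) ` carrier S"

context ring
begin

text \<open>
  The normal forms computed by \<open>algebra\<close> in a noncommutative ring keep factors \<open>\<one>\<close> on the right
  unless this rule is added.
\<close>

declare r_one [algebra add: ring "ring.zero R" "ring.add R" "a_inv R" "a_minus R" "monoid.one R" "monoid.mult R"]

lemma right_idealI:
  assumes "I \<subseteq> carrier R" "\<zero> \<in> I" "\<And>x y. x \<in> I \<Longrightarrow> y \<in> I \<Longrightarrow> x \<oplus> y \<in> I"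
    and "\<And>x a. x \<in> I \<Longrightarrow> a \<in> carrier R \<Longrightarrow> x \<otimes> a \<in> I"
  shows "right_ideal I R"
  unfolding right_ideal_def
proof (intro conjI ballI)
  \<comment> \<open>Negatives come from multiplication by \<open>\<ominus> \<one>\<close>.\<close>
  have inv: "\<ominus> x \<in> I" if "x \<in> I" for x
  proof -
    have "\<ominus> x = x \<otimes> (\<ominus> \<one>)" using that assms(1) by (simp add: r_minus subset_iff)
    then show ?thesis using assms(4)[OF that] by simp
  qed
  show "additive_subgroup I R"
    by (rule additive_subgroupI, unfold_locales)
       (use assms inv in \<open>auto simp: a_inv_def\<close>)
qed (use assms in auto)

lemma right_idealD:
  assumes "right_ideal I R"
  shows right_ideal_carrier: "x \<in> I \<Longrightarrow> x \<in> carrier R"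
    and right_ideal_zero: "\<zero> \<in> I"
    and right_ideal_add: "x \<in> I \<Longrightarrow> y \<in> I \<Longrightarrow> x \<oplus> y \<in> I"
    and right_ideal_minus: "x \<in> I \<Longrightarrow> y \<in> I \<Longrightarrow> x \<ominus> y \<in> I"
    and right_ideal_mult: "x \<in> I \<Longrightarrow> a \<in> carrier R \<Longrightarrow> x \<otimes> a \<in> I"
proof -
  interpret additive_subgroup I R using assms by (simp add: right_ideal_def)
  show "x \<in> I \<Longrightarrow> x \<in> carrier R" using a_subset by auto
  show "\<zero> \<in> I" by simp
  show "x \<in> I \<Longrightarrow> y \<in> I \<Longrightarrow> x \<oplus> y \<in> I" by simp
  show "x \<in> I \<Longrightarrow> y \<in> I \<Longrightarrow> x \<ominus> y \<in> I" by (simp add: a_minus_def)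
  show "x \<in> I \<Longrightarrow> a \<in> carrier R \<Longrightarrow> x \<otimes> a \<in> I" using assms by (simp add: right_ideal_def)
qed

lemma right_ideal_eq_carrier:
  assumes "right_ideal I R" "\<one> \<in> I"
  shows "I = carrier R"
  using right_idealD[OF assms(1)] assms(2) l_one by (metis subsetI subset_antisym)

lemma right_ideal_principal:
  assumes "a \<in> carrier R"
  shows "right_ideal (principal_right_ideal R a) R"
proof (rule right_idealI)
  show "principal_right_ideal R a \<subseteq> carrier R" "\<zero> \<in> principal_right_ideal R a"
    using assms by (auto simp: principal_right_ideal_def intro!: image_eqI[of _ _ "\<zero>"])
next
  fix x y assume "x \<in> principal_right_ideal R a" "y \<in> principal_right_ideal R a"
  then show "x \<oplus> y \<in> principal_right_ideal R a"
    using assms by (auto simp: principal_right_ideal_def r_distr[symmetric] intro!: imageI)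
next
  fix x y assume "x \<in> principal_right_ideal R a" "y \<in> carrier R"
  then show "x \<otimes> y \<in> principal_right_ideal R a"
    using assms by (auto simp: principal_right_ideal_def m_assoc intro!: imageI)
qed

lemma principal_self: "a \<in> carrier R \<Longrightarrow> a \<in> principal_right_ideal R a"
  unfolding principal_right_ideal_def by (rule image_eqI[of _ _ "\<one>"]) simp_all

lemma principal_least: "right_ideal I R \<Longrightarrow> a \<in> I \<Longrightarrow> principal_right_ideal R a \<subseteq> I"
  by (auto simp: principal_right_ideal_def right_ideal_mult)

lemma set_addI: "i \<in> I \<Longrightarrow> k \<in> K \<Longrightarrow> x = i \<oplus> k \<Longrightarrow> x \<in> I <+>\<^bsub>R\<^esub> K"
  by (auto simp: set_add_def')

lemma set_addE:
  assumes "x \<in> I <+>\<^bsub>R\<^esub> K"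
  obtains i k where "i \<in> I" "k \<in> K" "x = i \<oplus> k"
  using assms by (auto simp: set_add_def')

lemma right_ideal_set_add:
  assumes I: "right_ideal I R" and K: "right_ideal K R"
  shows "right_ideal (I <+>\<^bsub>R\<^esub> K) R"
proof (rule right_idealI)
  note d = right_idealD[OF I] right_idealD[OF K]
  show "I <+>\<^bsub>R\<^esub> K \<subseteq> carrier R"
    using d(1,6) by (auto elim!: set_addE)
  show "\<zero> \<in> I <+>\<^bsub>R\<^esub> K"
    by (rule set_addI[OF d(2,7)]) simp
  fix x assume "x \<in> I <+>\<^bsub>R\<^esub> K"
  then obtain i k where x: "i \<in> I" "k \<in> K" "x = i \<oplus> k" by (rule set_addE)
  {
    fix y assume "y \<in> I <+>\<^bsub>R\<^esub> K"
    then obtain i' k' where y: "i' \<in> I" "k' \<in> K" "y = i' \<oplus> k'" by (rule set_addE)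
    show "x \<oplus> y \<in> I <+>\<^bsub>R\<^esub> K"
      by (rule set_addI[OF d(3)[OF x(1) y(1)] d(8)[OF x(2) y(2)]])
         (simp add: x(3) y(3) a_ac d(1)[OF x(1)] d(1)[OF y(1)] d(6)[OF x(2)] d(6)[OF y(2)])
  next
    fix a assume a: "a \<in> carrier R"
    show "x \<otimes> a \<in> I <+>\<^bsub>R\<^esub> K"
      by (rule set_addI[OF d(5)[OF x(1) a] d(10)[OF x(2) a]])
         (simp add: x(3) l_distr a d(1)[OF x(1)] d(6)[OF x(2)])
  }
qed

lemma right_ideal_Int:
  assumes I: "right_ideal I R" and K: "right_ideal K R"
  shows "right_ideal (I \<inter> K) R"
  by (rule right_idealI) (auto simp: right_idealD[OF I] right_idealD[OF K])

lemma right_ideal_Inter: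
  assumes "\<And>I. I \<in> F \<Longrightarrow> right_ideal I R"
  shows "right_ideal (carrier R \<inter> \<Inter>F) R"
  by (rule right_idealI) (auto intro: right_idealD(2-5)[OF assms])

lemma subset_set_add:
  assumes I: "right_ideal I R" and K: "right_ideal K R"
  shows "I \<subseteq> I <+>\<^bsub>R\<^esub> K" "K \<subseteq> I <+>\<^bsub>R\<^esub> K"
proof -
  note d = right_idealD[OF I] right_idealD[OF K]
  show "I \<subseteq> I <+>\<^bsub>R\<^esub> K" using d(1) by (auto intro: set_addI[OF _ d(7)])
  show "K \<subseteq> I <+>\<^bsub>R\<^esub> K" using d(6) by (auto intro: set_addI[OF d(2)])
qed

text \<open>
  Zorn's lemma applies because a right ideal is proper exactly when it omits \<open>\<one>\<close>, a property that
  survives unions of chains.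
\<close>

lemma exists_maximal_right_ideal:
  assumes I: "right_ideal I R" and proper: "I \<noteq> carrier R"
  obtains N where "maximal_right_ideal N R" "I \<subseteq> N"
proof -
  define A where "A = {K. right_ideal K R \<and> I \<subseteq> K \<and> \<one> \<notin> K}"
  have "\<exists>N\<in>A. \<forall>L\<in>A. N \<subseteq> L \<longrightarrow> L = N"
  proof (rule subset_Zorn_nonempty)
    show "A \<noteq> {}" using I proper right_ideal_eq_carrier[OF I] by (auto simp: A_def)
  next
    fix C assume ne: "C \<noteq> {}" and C: "subset.chain A C"
    have mems: "\<And>K. K \<in> C \<Longrightarrow> right_ideal K R \<and> I \<subseteq> K \<and> \<one> \<notin> K"
      and tot: "\<And>K L. K \<in> C \<Longrightarrow> L \<in> C \<Longrightarrow> K \<subseteq> L \<or> L \<subseteq> K"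
      using C by (auto simp: subset_chain_def A_def)
    have "right_ideal (\<Union>C) R"
    proof (rule right_idealI)
      show "\<Union>C \<subseteq> carrier R" "\<zero> \<in> \<Union>C"
        using mems ne right_ideal_carrier right_ideal_zero by blast+
      show "\<And>x a. x \<in> \<Union>C \<Longrightarrow> a \<in> carrier R \<Longrightarrow> x \<otimes> a \<in> \<Union>C"
        using mems right_ideal_mult by blast
      fix x y assume "x \<in> \<Union>C" "y \<in> \<Union>C"
      then obtain K L where "K \<in> C" "L \<in> C" "x \<in> K" "y \<in> L" by blast
      then show "x \<oplus> y \<in> \<Union>C"
        using tot[of K L] mems right_ideal_add by (meson UnionI subsetD)
    qed
    then show "\<Union>C \<in> A" using mems ne unfolding A_def by blast
  qed
  then obtain N where "N \<in> A" and max: "\<And>L. L \<in> A \<Longrightarrow> N \<subseteq> L \<Longrightarrow> L = N"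
    by auto
  then have N: "right_ideal N R" "I \<subseteq> N" "\<one> \<notin> N" by (auto simp: A_def)
  have "K = N \<or> K = carrier R" if K: "right_ideal K R" "N \<subseteq> K" for K
  proof (cases "\<one> \<in> K")
    case False
    then have "K \<in> A" using K N(2) by (auto simp: A_def)
    then show ?thesis using max K(2) by blast
  qed (use right_ideal_eq_carrier K in blast)
  moreover have "N \<noteq> carrier R" using N(3) by auto
  ultimately have "maximal_right_ideal N R"
    using N(1) by (simp add: maximal_right_ideal_def)
  then show ?thesis using N(2) that by blast
qed

lemma right_ideal_jacobson: "right_ideal (jacobson_radical R) R"
  unfolding jacobson_radical_def
  by (rule right_ideal_Inter) (simp add: maximal_right_ideal_def)

text \<open>
  If \<open>c\<close> is the inverse of \<open>1 - ab\<close>, then \<open>1 + bca\<close> is the inverse of \<open>1 - ba\<close>. This is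
  why the radical, defined by right ideals, is a left ideal as well.
\<close>

lemma unit_swap:
  assumes a: "a \<in> carrier R" and b: "b \<in> carrier R" and u: "\<one> \<ominus> a \<otimes> b \<in> Units R"
  shows "\<one> \<ominus> b \<otimes> a \<in> Units R"
proof -
  define c where "c = inv (\<one> \<ominus> a \<otimes> b)"
  have c: "c \<in> carrier R" "(\<one> \<ominus> a \<otimes> b) \<otimes> c = \<one>" "c \<otimes> (\<one> \<ominus> a \<otimes> b) = \<one>"
    using u by (simp_all add: c_def Units_l_inv Units_r_inv)
  let ?w = "\<one> \<oplus> b \<otimes> c \<otimes> a"
  have "(\<one> \<ominus> b \<otimes> a) \<otimes> ?w = \<one> \<ominus> b \<otimes> a \<oplus> b \<otimes> ((\<one> \<ominus> a \<otimes> b) \<otimes> c) \<otimes> a"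
    using a b c(1) by algebra
  also have "\<dots> = \<one>" unfolding c(2) using a b by algebra
  finally have 1: "(\<one> \<ominus> b \<otimes> a) \<otimes> ?w = \<one>" .
  have "?w \<otimes> (\<one> \<ominus> b \<otimes> a) = \<one> \<ominus> b \<otimes> a \<oplus> b \<otimes> (c \<otimes> (\<one> \<ominus> a \<otimes> b)) \<otimes> a"
    using a b c(1) by algebra
  also have "\<dots> = \<one>" unfolding c(3) using a b by algebra
  finally have 2: "?w \<otimes> (\<one> \<ominus> b \<otimes> a) = \<one>" .
  show ?thesis
    unfolding Units_def using 1 2 a b c(1) by (intro CollectI conjI bexI[of _ ?w]) simp_all
qed

text \<open>
  Otherwise \<open>(1 - y)R\<close> would lie in a maximal right ideal, which also contains \<open>y\<close>, hence \<open>1\<close>.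
\<close>

lemma jacobson_right_inverse:
  assumes y: "y \<in> jacobson_radical R"
  obtains c where "c \<in> carrier R" "(\<one> \<ominus> y) \<otimes> c = \<one>"
proof -
  have yc: "y \<in> carrier R" using y by (simp add: jacobson_radical_def)
  let ?P = "principal_right_ideal R (\<one> \<ominus> y)"
  have P: "right_ideal ?P R" using yc by (simp add: right_ideal_principal)
  have "?P = carrier R"
  proof (rule ccontr)
    assume "?P \<noteq> carrier R"
    then obtain N where N: "maximal_right_ideal N R" "?P \<subseteq> N"
      using exists_maximal_right_ideal[OF P] by blast
    then have rN: "right_ideal N R" by (simp add: maximal_right_ideal_def)
    have "y \<in> N" using y N(1) by (simp add: jacobson_radical_def)
    moreover have "\<one> \<ominus> y \<in> N" using N(2) principal_self[of "\<one> \<ominus> y"] yc by auto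
    ultimately have "(\<one> \<ominus> y) \<oplus> y \<in> N" using right_ideal_add[OF rN] by blast
    moreover have "(\<one> \<ominus> y) \<oplus> y = \<one>" using yc by algebra
    ultimately show False
      using right_ideal_eq_carrier[OF rN] N(1) by (simp add: maximal_right_ideal_def)
  qed
  then have "\<one> \<in> ?P" by simp
  then show ?thesis using that by (auto simp: principal_right_ideal_def)
qed

text \<open>
  This description of the radical is what shows that it is two-sided and that units lift modulo
  it.
\<close>

lemma jacobson_radical_iff:
  "x \<in> jacobson_radical R \<longleftrightarrow>
     x \<in> carrier R \<and> (\<forall>r\<in>carrier R. \<one> \<ominus> x \<otimes> r \<in> Units R)"
proof (intro iffI conjI ballI)
  assume x: "x \<in> jacobson_radical R"
  then show "x \<in> carrier R" by (simp add: jacobson_radical_def)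
  fix r assume r: "r \<in> carrier R"
  define y where "y = x \<otimes> r"
  note J = right_idealD[OF right_ideal_jacobson]
  have y: "y \<in> jacobson_radical R" "y \<in> carrier R"
    using x r J unfolding y_def by blast+
  obtain c where c: "c \<in> carrier R" "(\<one> \<ominus> y) \<otimes> c = \<one>"
    using jacobson_right_inverse[OF y(1)] .
  \<comment> \<open>As \<open>c = 1 + yc\<close> has the same form as \<open>1 - y\<close>, it has a right inverse \<open>d\<close>; its left inverse
    \<open>1 - y\<close> must then be equal to \<open>d\<close>.\<close>
  have "y \<otimes> (\<ominus> c) \<in> jacobson_radical R" using y c J by simp
  then obtain d where d: "d \<in> carrier R" "(\<one> \<ominus> y \<otimes> (\<ominus> c)) \<otimes> d = \<one>"
    using jacobson_right_inverse by blast
  have "\<one> \<ominus> y \<otimes> (\<ominus> c) = (\<one> \<ominus> y) \<otimes> c \<oplus> y \<otimes> c"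
    unfolding c(2) using y c(1) by algebra
  also have "\<dots> = c" using y c(1) by algebra
  finally have cd: "c \<otimes> d = \<one>" using d by simp
  have "d = (\<one> \<ominus> y) \<otimes> c \<otimes> d" using c d by simp
  also have "\<dots> = \<one> \<ominus> y" using y(2) c(1) d(1) cd by (simp add: m_assoc)
  finally have "d = \<one> \<ominus> y" .
  then have "\<one> \<ominus> y \<in> Units R"
    unfolding Units_def using c cd y(2) by (intro CollectI conjI bexI[of _ c]) simp_all
  then show "\<one> \<ominus> x \<otimes> r \<in> Units R" by (simp add: y_def)
next
  assume x: "x \<in> carrier R \<and> (\<forall>r\<in>carrier R. \<one> \<ominus> x \<otimes> r \<in> Units R)"
  have "x \<in> N" if "maximal_right_ideal N R" for N
  proof (rule ccontr)
    assume xN: "x \<notin> N"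
    have N: "right_ideal N R" "N \<noteq> carrier R"
      and max: "\<And>K. right_ideal K R \<Longrightarrow> N \<subseteq> K \<Longrightarrow> K = N \<or> K = carrier R"
      using that by (auto simp: maximal_right_ideal_def)
    let ?P = "principal_right_ideal R x"
    have P: "right_ideal ?P R" using x right_ideal_principal by simp
    \<comment> \<open>Then \<open>1 = n + xr\<close> with \<open>n \<in> N\<close>, so \<open>N\<close> contains the unit \<open>n = 1 - xr\<close>.\<close>
    have "N <+>\<^bsub>R\<^esub> ?P = carrier R"
      using max[OF right_ideal_set_add[OF N(1) P]] subset_set_add[OF N(1) P] xN
        principal_self[of x] x by blast
    then have "\<one> \<in> N <+>\<^bsub>R\<^esub> ?P" by simp
    then obtain n r where n: "n \<in> N" "r \<in> carrier R" "\<one> = n \<oplus> x \<otimes> r"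
      by (auto elim!: set_addE simp: principal_right_ideal_def)
    have "n = (n \<oplus> x \<otimes> r) \<ominus> x \<otimes> r"
      using n(1,2) x right_ideal_carrier[OF N(1)] by algebra
    then have "n = \<one> \<ominus> x \<otimes> r" by (simp only: n(3)[symmetric])
    then have "n \<in> Units R" using n(2) x by simp
    then have "\<one> \<in> N"
      using right_ideal_mult[OF N(1) n(1), of "inv n"] Units_r_inv Units_inv_closed by metis
    then show False using right_ideal_eq_carrier[OF N(1)] N(2) by simp
  qed
  then show "x \<in> jacobson_radical R" using x by (simp add: jacobson_radical_def)
qed

lemma ideal_jacobson: "ideal (jacobson_radical R) R"
proof (rule idealI)
  note J = right_idealD[OF right_ideal_jacobson]
  show "ring R" by (rule ring_axioms)
  show "subgroup (jacobson_radical R) (add_monoid R)"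
    using right_ideal_jacobson by (simp add: right_ideal_def additive_subgroup_def)
  fix a x assume a: "a \<in> jacobson_radical R" and x: "x \<in> carrier R"
  show "a \<otimes> x \<in> jacobson_radical R" using J(5) a x .
  have ac: "a \<in> carrier R" using J(1) a .
  have "\<one> \<ominus> (x \<otimes> a) \<otimes> r \<in> Units R" if r: "r \<in> carrier R" for r
  proof -
    have "\<one> \<ominus> a \<otimes> (r \<otimes> x) \<in> Units R" using a x r by (simp add: jacobson_radical_iff)
    then have "\<one> \<ominus> (a \<otimes> r) \<otimes> x \<in> Units R" using ac x r by (simp add: m_assoc)
    then have "\<one> \<ominus> x \<otimes> (a \<otimes> r) \<in> Units R" using unit_swap[of "a \<otimes> r" x] ac x r by simp
    then show ?thesis using ac x r by (simp add: m_assoc)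
  qed
  with ac x show "x \<otimes> a \<in> jacobson_radical R"
    by (intro jacobson_radical_iff[THEN iffD2] conjI ballI m_closed)
qed

text \<open>
  Hides the cosets: the quotient by the radical is seen through a surjective homomorphism whose
  kernel is the radical.
\<close>

lemma jacobson_quotient:
  defines "Q \<equiv> R Quot jacobson_radical R" and "h \<equiv> (+>) (jacobson_radical R)"
  shows jacobson_hom: "ring_hom_ring R Q h"
    and jacobson_surj: "z \<in> carrier Q \<Longrightarrow> \<exists>x\<in>carrier R. z = h x"
    and jacobson_kernel: "x \<in> carrier R \<Longrightarrow> h x = \<zero>\<^bsub>Q\<^esub> \<longleftrightarrow> x \<in> jacobson_radical R"
proof -
  interpret J: ideal "jacobson_radical R" R by (rule ideal_jacobson)
  show "ring_hom_ring R Q h" unfolding Q_def h_def by (rule J.rcos_ring_hom_ring)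
  show "z \<in> carrier Q \<Longrightarrow> \<exists>x\<in>carrier R. z = h x"
    by (auto simp: Q_def h_def FactRing_def A_RCOSETS_def')
  show "h x = \<zero>\<^bsub>Q\<^esub> \<longleftrightarrow> x \<in> jacobson_radical R" if "x \<in> carrier R"
    using J.a_rcos_const[of x] J.a_rcos_self[OF that] by (auto simp: Q_def h_def FactRing_def)
qed

lemma unit_of_unit_mod_jacobson:
  defines "h \<equiv> (+>) (jacobson_radical R)"
  assumes x: "x \<in> carrier R" and hx: "h x = h \<one>"
  shows "x \<in> Units R"
proof -
  interpret h: ring_hom_ring R "R Quot jacobson_radical R" h
    unfolding h_def by (rule jacobson_hom)
  have "h (\<one> \<ominus> x) = \<zero>\<^bsub>R Quot jacobson_radical R\<^esub>"
    using x hx h.hom_one by (simp add: a_minus_def h.S.r_neg)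
  then have "\<one> \<ominus> x \<in> jacobson_radical R"
    using jacobson_kernel[of "\<one> \<ominus> x"] x by (simp add: h_def)
  then have "\<one> \<ominus> (\<one> \<ominus> x) \<otimes> \<one> \<in> Units R"
    unfolding jacobson_radical_iff by blast
  moreover have "\<one> \<ominus> (\<one> \<ominus> x) \<otimes> \<one> = x" using x by algebra
  ultimately show ?thesis by simp
qed

end


section \<open>Ranks detecting units\<close>

text \<open>
  An example is the length of \<open>aS\<close> for a semisimple artinian ring \<open>S\<close>, since the right annihilator
  of \<open>a(1 - ba)\<close> is the direct sum of those of \<open>a\<close> and \<open>1 - ba\<close>. Well-founded values instead of natural numbers
  spare the theory of length. Equality in the unit case is what allows ranks of several rings to be
  combined lexicographically.
\<close>

definition unit_rank :: "('a, 'r) ring_scheme \<Rightarrow> ('a \<Rightarrow> 'o) \<Rightarrow> ('o \<times> 'o) set \<Rightarrow> bool"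
  where "unit_rank S f r \<longleftrightarrow> wf r \<and>
    (\<forall>a\<in>carrier S. \<forall>b\<in>carrier S.
      let u = \<one>\<^bsub>S\<^esub> \<ominus>\<^bsub>S\<^esub> b \<otimes>\<^bsub>S\<^esub> a
      in if u \<in> Units S then f (a \<otimes>\<^bsub>S\<^esub> u) = f a else (f (a \<otimes>\<^bsub>S\<^esub> u), f a) \<in> r)"

lemma unit_rankD:
  assumes "unit_rank S f r"
  shows unit_rank_wf: "wf r"
    and unit_rank_unit: "a \<in> carrier S \<Longrightarrow> b \<in> carrier S \<Longrightarrow>
      \<one>\<^bsub>S\<^esub> \<ominus>\<^bsub>S\<^esub> b \<otimes>\<^bsub>S\<^esub> a \<in> Units S \<Longrightarrow> f (a \<otimes>\<^bsub>S\<^esub> (\<one>\<^bsub>S\<^esub> \<ominus>\<^bsub>S\<^esub> b \<otimes>\<^bsub>S\<^esub> a)) = f a"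
    and unit_rank_nonunit: "a \<in> carrier S \<Longrightarrow> b \<in> carrier S \<Longrightarrow>
      \<one>\<^bsub>S\<^esub> \<ominus>\<^bsub>S\<^esub> b \<otimes>\<^bsub>S\<^esub> a \<notin> Units S \<Longrightarrow> (f (a \<otimes>\<^bsub>S\<^esub> (\<one>\<^bsub>S\<^esub> \<ominus>\<^bsub>S\<^esub> b \<otimes>\<^bsub>S\<^esub> a)), f a) \<in> r"
  using assms unfolding unit_rank_def Let_def by metis+

lemma artinian_ring_wf:
  assumes "artinian_ring S"
  shows "wf {(K, L). right_ideal K S \<and> right_ideal L S \<and> K \<subset> L}"
  unfolding wf_iff_no_infinite_down_chain
proof
  assume "\<exists>I. \<forall>i. (I (Suc i), I i) \<in> {(K, L). right_ideal K S \<and> right_ideal L S \<and> K \<subset> L}"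
  then obtain I where I: "\<And>i. right_ideal (I i) S" "\<And>i. I (Suc i) \<subset> I i" by blast
  then have "\<forall>n. right_ideal (I n) S \<and> I (Suc n) \<subseteq> I n" by blast
  then obtain n where "\<forall>m\<ge>n. I m = I n" using assms unfolding artinian_ring_def by blast
  then have "I (Suc n) = I n" using le_SucI[OF order_refl] by blast
  then show False using I(2)[of n] by blast
qed

context ring
begin

text \<open>
  Among the elements with a left inverse choose \<open>z\<close> with \<open>zR\<close> minimal. Then \<open>zy\<close> has a left inverse
  as well, so \<open>zyR = zR\<close>, and cancelling \<open>z\<close> in \<open>z = zyc\<close> gives a right inverse of \<open>y\<close>.
\<close>

lemma artinian_left_inverse:
  assumes art: "artinian_ring R"
    and x: "x \<in> carrier R" and y: "y \<in> carrier R" and xy: "x \<otimes> y = \<one>"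
  shows "y \<otimes> x = \<one>"
proof -
  let ?D = "{(K, L). right_ideal K R \<and> right_ideal L R \<and> K \<subset> L}"
  define Z where "Z = {z \<in> carrier R. \<exists>w\<in>carrier R. w \<otimes> z = \<one>}"
  have "wf (inv_image ?D (principal_right_ideal R))"
    using artinian_ring_wf[OF art] by (rule wf_inv_image)
  moreover have "y \<in> Z" using x y xy by (auto simp: Z_def)
  ultimately obtain z where z: "z \<in> Z"
    and min: "\<And>z'. (z', z) \<in> inv_image ?D (principal_right_ideal R) \<Longrightarrow> z' \<notin> Z"
    by (rule wfE_min) blast
  obtain w where w: "w \<in> carrier R" "w \<otimes> z = \<one>" and zc: "z \<in> carrier R"
    using z by (auto simp: Z_def)
  have "(x \<otimes> w) \<otimes> (z \<otimes> y) = x \<otimes> (w \<otimes> z) \<otimes> y" using x y w(1) zc by algebra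
  then have "(x \<otimes> w) \<otimes> (z \<otimes> y) = \<one>" using x y xy w(2) by simp
  then have zy: "z \<otimes> y \<in> Z" using x y w(1) zc by (auto simp: Z_def)
  have "z \<otimes> y \<in> principal_right_ideal R z" using y by (simp add: principal_right_ideal_def)
  then have sub: "principal_right_ideal R (z \<otimes> y) \<subseteq> principal_right_ideal R z"
    using principal_least right_ideal_principal zc by blast
  have "principal_right_ideal R (z \<otimes> y) = principal_right_ideal R z"
    using min[of "z \<otimes> y"] zy sub zc y right_ideal_principal by (auto simp: in_inv_image)
  then have "z \<in> principal_right_ideal R (z \<otimes> y)" using principal_self zc by simp
  then obtain c where c: "c \<in> carrier R" "z = z \<otimes> y \<otimes> c"
    by (auto simp: principal_right_ideal_def)
  have "\<one> = w \<otimes> (z \<otimes> y \<otimes> c)" using w c by simp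
  also have "\<dots> = (w \<otimes> z) \<otimes> (y \<otimes> c)" using w(1) zc y c(1) by algebra
  finally have yc: "y \<otimes> c = \<one>" using w(2) y c(1) by simp
  have "x = c" using inv_unique[OF xy yc] x y c(1) by simp
  then show ?thesis using yc by simp
qed

lemma unit_of_unit_products:
  assumes u: "u \<in> carrier R" and t: "t \<in> carrier R"
    and ut: "u \<otimes> t \<in> Units R" and tu: "t \<otimes> u \<in> Units R"
  shows "u \<in> Units R"
proof -
  define p q where "p = t \<otimes> inv (u \<otimes> t)" and "q = inv (t \<otimes> u) \<otimes> t"
  have c: "p \<in> carrier R" "q \<in> carrier R" using t ut tu by (simp_all add: p_def q_def)
  have p: "u \<otimes> p = \<one>"
    using Units_r_inv[OF ut] u t Units_inv_closed[OF ut] by (simp add: p_def m_assoc)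
  have q: "q \<otimes> u = \<one>"
    using Units_l_inv[OF tu] u t Units_inv_closed[OF tu] by (simp add: q_def m_assoc)
  have "q = p" using inv_unique[OF q p] u c by simp
  then show ?thesis
    unfolding Units_def using u c p q by (intro CollectI conjI bexI[of _ p]) simp_all
qed

text \<open>
  The value at \<open>a\<close> is the right ideal generated by the class of \<open>a\<close> modulo the radical. It can only
  be the same for \<open>au\<close>, where \<open>u = 1 - ba\<close>, if \<open>u\<close> is invertible modulo the radical.
\<close>

lemma unit_rank_of_semilocal:
  defines "Q \<equiv> R Quot jacobson_radical R" and "h \<equiv> (+>) (jacobson_radical R)"
  assumes semilocal: "semilocal_ring R"
  shows "unit_rank R (\<lambda>a. principal_right_ideal Q (h a))
    {(K, L). right_ideal K Q \<and> right_ideal L Q \<and> K \<subset> L}"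
proof -
  have art: "artinian_ring Q" using semilocal by (simp add: Q_def semilocal_ring_def)
  interpret h: ring_hom_ring R Q h unfolding Q_def h_def by (rule jacobson_hom)
  show ?thesis unfolding unit_rank_def Let_def
  proof (intro conjI ballI)
    show "wf {(K, L). right_ideal K Q \<and> right_ideal L Q \<and> K \<subset> L}"
      by (rule artinian_ring_wf[OF art])
    fix a b assume a: "a \<in> carrier R" and b: "b \<in> carrier R"
    define u where "u = \<one> \<ominus> b \<otimes> a"
    have u: "u \<in> carrier R" using a b by (simp add: u_def)
    let ?P = "\<lambda>a. principal_right_ideal Q (h a)"
    have P: "right_ideal (?P x) Q" if "x \<in> carrier R" for x
      using that h.S.right_ideal_principal by simp
    have sub: "?P (x \<otimes> y) \<subseteq> ?P x" if x: "x \<in> carrier R" and y: "y \<in> carrier R" for x y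
    proof (rule h.S.principal_least[OF P[OF x]])
      show "h (x \<otimes> y) \<in> ?P x" using x y by (auto simp: principal_right_ideal_def)
    qed
    have "?P (a \<otimes> u) = ?P a" if unit: "u \<in> Units R"
    proof
      have "a \<otimes> u \<otimes> inv u = a" using a u unit by (simp add: m_assoc)
      then show "?P a \<subseteq> ?P (a \<otimes> u)" using sub[of "a \<otimes> u" "inv u"] a u unit by simp
    qed (rule sub[OF a u])
    moreover have "?P (a \<otimes> u) \<subset> ?P a" if nonunit: "u \<notin> Units R"
    proof (rule psubsetI[OF sub[OF a u]])
      show "?P (a \<otimes> u) \<noteq> ?P a"
      proof
        assume "?P (a \<otimes> u) = ?P a"
        then have "h a \<in> ?P (a \<otimes> u)" using h.S.principal_self[of "h a"] a by simp
        then obtain z where z: "z \<in> carrier Q" "h a = h (a \<otimes> u) \<otimes>\<^bsub>Q\<^esub> z"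
          by (auto simp: principal_right_ideal_def)
        obtain y where y: "y \<in> carrier R" "z = h y"
          using jacobson_surj[of z] z(1) unfolding Q_def h_def by blast
        \<comment> \<open>Modulo the radical \<open>a = auy\<close>, and \<open>ba = 1 - u\<close> commutes with \<open>u\<close>, so
          \<open>1 = u + ba = u + bauy = u(1 + bay)\<close>.\<close>
        define t where "t = \<one> \<oplus> b \<otimes> a \<otimes> y"
        have t: "t \<in> carrier R" using a b y by (simp add: t_def)
        have eq: "h a = h (a \<otimes> u \<otimes> y)" using z(2) y a u by simp
        have "h (u \<otimes> t) = h (u \<oplus> b \<otimes> (a \<otimes> u \<otimes> y))"
          unfolding u_def t_def using a b y(1) by (intro arg_cong[of _ _ h]) algebra
        also have "\<dots> = h u \<oplus>\<^bsub>Q\<^esub> h b \<otimes>\<^bsub>Q\<^esub> h (a \<otimes> u \<otimes> y)" using a b u y(1) by simp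
        also have "\<dots> = h u \<oplus>\<^bsub>Q\<^esub> h b \<otimes>\<^bsub>Q\<^esub> h a" by (simp only: eq)
        also have "\<dots> = h (u \<oplus> b \<otimes> a)" using a b u by simp
        also have "u \<oplus> b \<otimes> a = \<one>" unfolding u_def using a b by algebra
        finally have ut: "h (u \<otimes> t) = h \<one>" .
        have "h t \<otimes>\<^bsub>Q\<^esub> h u = \<one>\<^bsub>Q\<^esub>"
          using h.S.artinian_left_inverse[OF art, of "h u" "h t"] ut u t by simp
        then have tu: "h (t \<otimes> u) = h \<one>" using t u by simp
        have "u \<otimes> t \<in> Units R" "t \<otimes> u \<in> Units R"
          using unit_of_unit_mod_jacobson ut tu u t unfolding h_def by simp_all
        then show False using unit_of_unit_products[OF u t] nonunit by blast
      qed
    qed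
    ultimately show "if \<one> \<ominus> b \<otimes> a \<in> Units R then ?P (a \<otimes> (\<one> \<ominus> b \<otimes> a)) = ?P a
        else (?P (a \<otimes> (\<one> \<ominus> b \<otimes> a)), ?P a) \<in> {(K, L). right_ideal K Q \<and> right_ideal L Q \<and> K \<subset> L}"
      using P[OF a] P[of "a \<otimes> u"] a u unfolding u_def[symmetric] by auto
  qed
qed


section \<open>Complemented right ideals with the ascending chain condition\<close>

text \<open>
  The modular law: \<open>K = K \<inter> (L + D) = L + (K \<inter> D)\<close>.
\<close>

lemma right_ideal_eq_of_complement:
  assumes L: "right_ideal L R" and K: "right_ideal K R" and D: "right_ideal D R"
    and sub: "L \<subseteq> K" and sum: "L <+>\<^bsub>R\<^esub> D = carrier R" and int: "K \<inter> D = {\<zero>}"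
  shows "L = K"
proof
  show "K \<subseteq> L"
  proof
    fix x assume x: "x \<in> K"
    note k = right_idealD[OF K] and l = right_idealD[OF L] and d = right_idealD[OF D]
    have "x \<in> L <+>\<^bsub>R\<^esub> D" using k(1) x sum by simp
    then obtain i j where ij: "i \<in> L" "j \<in> D" "x = i \<oplus> j" by (rule set_addE)
    have iK: "i \<in> K" using sub ij(1) by blast
    have "j = x \<ominus> i" using ij(3) l(1)[OF ij(1)] d(1)[OF ij(2)] by algebra
    then have "j \<in> K \<inter> D" using k(4)[OF x iK] ij(2) by simp
    then have "x = i" using int ij(3) l(1)[OF ij(1)] by simp
    then show "x \<in> L" using ij(1) by simp
  qed
qed (rule sub)

definition complement_right_ideal :: "'a set \<Rightarrow> 'a set \<Rightarrow> bool"
  where "complement_right_ideal K D \<longleftrightarrow>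
    right_ideal D R \<and> K <+>\<^bsub>R\<^esub> D = carrier R \<and> K \<inter> D = {\<zero>}"

text \<open>
  The second assumption is the ascending chain condition, in the form of the maximum principle.
\<close>

context
  assumes complement: "\<And>K. right_ideal K R \<Longrightarrow> \<exists>D. complement_right_ideal K D"
    and maximal: "\<And>F. F \<noteq> {} \<Longrightarrow> (\<And>K. K \<in> F \<Longrightarrow> right_ideal K R) \<Longrightarrow>
      \<exists>K\<in>F. \<forall>L\<in>F. K \<subseteq> L \<longrightarrow> L = K"
begin

text \<open>
  Complementation reverses the order: a member of \<open>G\<close> with a maximal complement \<open>D\<close> among all
  complements of members is minimal. For if \<open>L \<subseteq> K\<close> with \<open>D\<close> a complement of \<open>K\<close> and \<open>E\<close> one of \<open>L\<close>,
  then \<open>D + (K \<inter> E)\<close> is a complement of \<open>L\<close> above \<open>D\<close>; so it is \<open>D\<close>, and \<open>L = K\<close> by the modular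
  law.
\<close>

lemma right_ideal_minimum:
  assumes ne: "G \<noteq> {}" and G: "\<And>K. K \<in> G \<Longrightarrow> right_ideal K R"
  obtains K where "K \<in> G" "\<And>L. L \<in> G \<Longrightarrow> L \<subseteq> K \<Longrightarrow> L = K"
proof -
  define F where "F = {D. \<exists>K\<in>G. complement_right_ideal K D}"
  have "F \<noteq> {}" using ne G complement unfolding F_def by blast
  moreover have "\<And>D. D \<in> F \<Longrightarrow> right_ideal D R"
    unfolding F_def complement_right_ideal_def by blast
  ultimately obtain D where "D \<in> F" and max: "\<And>E. E \<in> F \<Longrightarrow> D \<subseteq> E \<Longrightarrow> E = D"
    using maximal[of F] by metis
  then obtain K where K: "K \<in> G" "complement_right_ideal K D" unfolding F_def by blast
  have Kr: "right_ideal K R" using G K(1) .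
  have D: "right_ideal D R" "K <+>\<^bsub>R\<^esub> D = carrier R" "K \<inter> D = {\<zero>}"
    using K(2) by (simp_all add: complement_right_ideal_def)
  have "L = K" if L: "L \<in> G" "L \<subseteq> K" for L
  proof -
    have Lr: "right_ideal L R" using G L(1) .
    obtain E where E: "right_ideal E R" "L <+>\<^bsub>R\<^esub> E = carrier R" "L \<inter> E = {\<zero>}"
      using complement[OF Lr] unfolding complement_right_ideal_def by blast
    note k = right_idealD[OF Kr] and l = right_idealD[OF Lr]
      and d = right_idealD[OF D(1)] and e = right_idealD[OF E(1)]
    have KE: "right_ideal (K \<inter> E) R" using right_ideal_Int[OF Kr E(1)] .
    define C where "C = D <+>\<^bsub>R\<^esub> (K \<inter> E)"
    have C: "right_ideal C R" unfolding C_def by (rule right_ideal_set_add[OF D(1) KE])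
    have "L <+>\<^bsub>R\<^esub> C = carrier R"
    proof (rule right_ideal_eq_carrier[OF right_ideal_set_add[OF Lr C]])
      obtain i j where ij: "i \<in> K" "j \<in> D" "\<one> = i \<oplus> j"
        using D(2) one_closed by (metis set_addE)
      obtain p q where pq: "p \<in> L" "q \<in> E" "i = p \<oplus> q"
        using E(2) k(1)[OF ij(1)] by (metis set_addE)
      have pK: "p \<in> K" using L(2) pq(1) by blast
      have "q = i \<ominus> p" using pq(3) l(1)[OF pq(1)] e(1)[OF pq(2)] by algebra
      then have q: "q \<in> K \<inter> E" using k(4)[OF ij(1) pK] pq(2) by simp
      show "\<one> \<in> L <+>\<^bsub>R\<^esub> C"
      proof (rule set_addI[OF pq(1)])
        show "j \<oplus> q \<in> C" unfolding C_def by (rule set_addI[OF ij(2) q refl])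
        show "\<one> = p \<oplus> (j \<oplus> q)"
          unfolding ij(3) pq(3) using l(1)[OF pq(1)] e(1)[OF pq(2)] d(1)[OF ij(2)] by algebra
      qed
    qed
    moreover have "L \<inter> C = {\<zero>}"
    proof -
      have "x = \<zero>" if x: "x \<in> L" "x \<in> C" for x
      proof -
        obtain j q where jq: "j \<in> D" "q \<in> K \<inter> E" "x = j \<oplus> q"
          using x(2) unfolding C_def by (rule set_addE)
        have xK: "x \<in> K" and q: "q \<in> K" "q \<in> E" using x(1) L(2) jq(2) by auto
        have "j = x \<ominus> q" using jq(3) d(1)[OF jq(1)] e(1)[OF q(2)] by algebra
        then have "j \<in> K \<inter> D" using k(4)[OF xK q(1)] jq(1) by simp
        then have "x = q" using D(3) jq(3) e(1)[OF q(2)] by simp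
        then show ?thesis using E(3) x(1) q(2) by blast
      qed
      then show ?thesis using l(2) right_ideal_zero[OF C] by blast
    qed
    ultimately have "C \<in> F" using L(1) C unfolding F_def complement_right_ideal_def by blast
    moreover have "D \<subseteq> C" unfolding C_def by (rule subset_set_add(1)[OF D(1) KE])
    ultimately have "C = D" by (rule max)
    then have "L <+>\<^bsub>R\<^esub> D = carrier R" using \<open>L <+>\<^bsub>R\<^esub> C = carrier R\<close> by simp
    then show "L = K" by (rule right_ideal_eq_of_complement[OF Lr Kr D(1) L(2) _ D(3)])
  qed
  then show ?thesis using that K(1) by blast
qed

lemma artinian_of_complements: "artinian_ring R"
  unfolding artinian_ring_def
proof (intro conjI allI impI)
  fix I :: "nat \<Rightarrow> 'a set"
  assume I: "\<forall>n. right_ideal (I n) R \<and> I (Suc n) \<subseteq> I n"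
  obtain K where "K \<in> range I" and min: "\<And>L. L \<in> range I \<Longrightarrow> L \<subseteq> K \<Longrightarrow> L = K"
    using right_ideal_minimum[of "range I"] I by blast
  then obtain n where n: "K = I n" by blast
  have "I m = I n" if "m \<ge> n" for m
    using min[of "I m"] lift_Suc_antimono_le[of I n m] I that n by blast
  then show "\<exists>n. \<forall>m\<ge>n. I m = I n" by blast
qed (rule ring_axioms)

text \<open>
  A nonzero complement of the sum of the minimal right ideals would contain a minimal right ideal.
\<close>

lemma semisimple_of_complements: "semisimple_ring R"
proof -
  have "K = carrier R" if K: "right_ideal K R" "\<Union>{I. minimal_right_ideal I R} \<subseteq> K" for K
  proof -
    obtain D where D: "right_ideal D R" "K <+>\<^bsub>R\<^esub> D = carrier R" "K \<inter> D = {\<zero>}"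
      using complement[OF K(1)] unfolding complement_right_ideal_def by blast
    have "D = {\<zero>}"
    proof (rule ccontr)
      assume D0: "D \<noteq> {\<zero>}"
      define G where "G = {L. right_ideal L R \<and> L \<subseteq> D \<and> L \<noteq> {\<zero>}}"
      have "G \<noteq> {}" "\<And>L. L \<in> G \<Longrightarrow> right_ideal L R" using D0 D(1) by (auto simp: G_def)
      then obtain L where L: "L \<in> G" and min: "\<And>M. M \<in> G \<Longrightarrow> M \<subseteq> L \<Longrightarrow> M = L"
        using right_ideal_minimum by metis
      have "minimal_right_ideal L R"
        unfolding minimal_right_ideal_def using L min by (auto simp: G_def)
      then have "L \<subseteq> K \<inter> D" using K(2) L by (auto simp: G_def)
      then have "L = {\<zero>}" using D(3) L right_ideal_zero[of L] by (auto simp: G_def)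
      then show False using L by (simp add: G_def)
    qed
    then have "x \<in> K" if "x \<in> carrier R" for x
    proof -
      have "x \<in> K <+>\<^bsub>R\<^esub> D" using that D(2) by simp
      then obtain k where "k \<in> K" "x = k \<oplus> \<zero>"
        using \<open>D = {\<zero>}\<close> by (auto elim!: set_addE)
      then show ?thesis using right_ideal_carrier[OF K(1)] by simp
    qed
    then show ?thesis using right_ideal_carrier[OF K(1)] by blast
  qed
  moreover have "right_ideal (carrier R) R" by (rule right_idealI) auto
  moreover have "\<Union>{I. minimal_right_ideal I R} \<subseteq> carrier R"
    using right_ideal_carrier by (auto simp: minimal_right_ideal_def)
  ultimately have "right_ideal_sum R {I. minimal_right_ideal I R} = carrier R"
    unfolding right_ideal_sum_def by blast
  then show ?thesis using ring_axioms by (simp add: semisimple_ring_def)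
qed

end


section \<open>Rings with a unit-detecting rank are semilocal\<close>

text \<open>
  Minimality of rank is used over all \<open>a\<close> whose class \<open>h a\<close> satisfies \<open>1 - h a \<in> K\<close> for some \<open>K\<close> in
  a family \<open>F\<close> of right ideals of the quotient. It makes the right ideal generated by \<open>h a\<close> a
  complement of every \<open>L \<in> F\<close> that contains \<open>1 - h a\<close>, so two comparable such \<open>L\<close> are equal.
  One-element families give complements, general ones the maximum principle.
\<close>

lemma semilocal_of_unit_rank:
  assumes rank: "unit_rank R f r"
  shows "semilocal_ring R"
proof -
  define Q where "Q = R Quot jacobson_radical R"
  define h where "h = (+>) (jacobson_radical R)"
  interpret h: ring_hom_ring R Q h unfolding Q_def h_def by (rule jacobson_hom)
  have surj: "\<exists>x\<in>carrier R. z = h x" if "z \<in> carrier Q" for z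
    using jacobson_surj that unfolding Q_def h_def .
  have ker: "h x = \<zero>\<^bsub>Q\<^esub> \<longleftrightarrow> x \<in> jacobson_radical R" if "x \<in> carrier R" for x
    using jacobson_kernel[OF that] unfolding Q_def h_def .
  have key: "\<exists>K\<in>F. (\<exists>D. h.S.complement_right_ideal K D) \<and> (\<forall>L\<in>F. K \<subseteq> L \<longrightarrow> L = K)"
    if ne: "F \<noteq> {}" and F: "\<And>K. K \<in> F \<Longrightarrow> right_ideal K Q" for F
  proof -
    define A where "A = {a \<in> carrier R. \<exists>K\<in>F. \<one>\<^bsub>Q\<^esub> \<ominus>\<^bsub>Q\<^esub> h a \<in> K}"
    have "\<one> \<in> A"
      using ne F h.S.right_ideal_zero by (auto simp: A_def a_minus_def h.S.r_neg)
    then obtain a where a: "a \<in> A" and min: "\<And>a'. (a', a) \<in> inv_image r f \<Longrightarrow> a' \<notin> A"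
      using wfE_min[OF wf_inv_image[OF unit_rank_wf[OF rank], of f]] by metis
    obtain K where K: "K \<in> F" "\<one>\<^bsub>Q\<^esub> \<ominus>\<^bsub>Q\<^esub> h a \<in> K" and ac: "a \<in> carrier R"
      using a by (auto simp: A_def)
    have Kr: "right_ideal K Q" using F K(1) .
    define D where "D = principal_right_ideal Q (h a)"
    have D: "right_ideal D Q" unfolding D_def using ac h.S.right_ideal_principal by simp
    have int: "L \<inter> D = {\<zero>\<^bsub>Q\<^esub>}" if L: "L \<in> F" "\<one>\<^bsub>Q\<^esub> \<ominus>\<^bsub>Q\<^esub> h a \<in> L" for L
    proof -
      have Lr: "right_ideal L Q" using F L(1) .
      note l = h.S.right_idealD[OF Lr]
      have "z = \<zero>\<^bsub>Q\<^esub>" if z: "z \<in> L" "z \<in> D" for z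
      proof -
        obtain b where b: "b \<in> carrier R" "z = h a \<otimes>\<^bsub>Q\<^esub> h b"
          using z(2) surj unfolding D_def principal_right_ideal_def by blast
        have "\<one> \<ominus> (a \<otimes> b) \<otimes> s \<in> Units R" if s: "s \<in> carrier R" for s
        proof -
          define c where "c = b \<otimes> s"
          have c: "c \<in> carrier R" using b s by (simp add: c_def)
          have "h (a \<otimes> c) = z \<otimes>\<^bsub>Q\<^esub> h s"
            using ac b s by (simp add: c_def h.S.m_assoc)
          then have "h (a \<otimes> c) \<in> L" using l(5)[OF z(1)] s by simp
          then have "h (a \<otimes> c) \<otimes>\<^bsub>Q\<^esub> h a \<in> L" using l(5) ac by simp
          \<comment> \<open>Passing from \<open>a\<close> to \<open>a(1 - ca)\<close> changes \<open>1 - a\<close> by \<open>aca\<close>, which stays in \<open>L\<close>.\<close>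
          then have "(\<one>\<^bsub>Q\<^esub> \<ominus>\<^bsub>Q\<^esub> h a) \<oplus>\<^bsub>Q\<^esub> h (a \<otimes> c) \<otimes>\<^bsub>Q\<^esub> h a \<in> L" using l(3)[OF L(2)] by blast
          also have "(\<one>\<^bsub>Q\<^esub> \<ominus>\<^bsub>Q\<^esub> h a) \<oplus>\<^bsub>Q\<^esub> h (a \<otimes> c) \<otimes>\<^bsub>Q\<^esub> h a
              = h ((\<one> \<ominus> a) \<oplus> (a \<otimes> c) \<otimes> a)"
            using ac c by (simp add: a_minus_def)
          also have "(\<one> \<ominus> a) \<oplus> (a \<otimes> c) \<otimes> a = \<one> \<ominus> a \<otimes> (\<one> \<ominus> c \<otimes> a)"
            using ac c by algebra
          also have "h (\<one> \<ominus> a \<otimes> (\<one> \<ominus> c \<otimes> a)) = \<one>\<^bsub>Q\<^esub> \<ominus>\<^bsub>Q\<^esub> h (a \<otimes> (\<one> \<ominus> c \<otimes> a))"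
            using ac c by (simp add: a_minus_def)
          finally have "a \<otimes> (\<one> \<ominus> c \<otimes> a) \<in> A" using L(1) ac c by (auto simp: A_def)
          then have "(f (a \<otimes> (\<one> \<ominus> c \<otimes> a)), f a) \<notin> r" using min by (auto simp: in_inv_image)
          then have "\<one> \<ominus> c \<otimes> a \<in> Units R" using unit_rank_nonunit[OF rank ac c] by blast
          then have "\<one> \<ominus> a \<otimes> c \<in> Units R" by (rule unit_swap[OF c ac])
          then show ?thesis using ac b s by (simp add: c_def m_assoc)
        qed
        then have "a \<otimes> b \<in> jacobson_radical R" using ac b by (simp add: jacobson_radical_iff)
        then show ?thesis using ker[of "a \<otimes> b"] ac b by simp
      qed
      then show ?thesis using l(2) h.S.right_ideal_zero[OF D] by blast
    qed
    have sum: "K <+>\<^bsub>Q\<^esub> D = carrier Q"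
    proof (rule h.S.right_ideal_eq_carrier[OF h.S.right_ideal_set_add[OF Kr D]])
      have "h a \<in> D" unfolding D_def using h.S.principal_self ac by simp
      moreover have "\<one>\<^bsub>Q\<^esub> = (\<one>\<^bsub>Q\<^esub> \<ominus>\<^bsub>Q\<^esub> h a) \<oplus>\<^bsub>Q\<^esub> h a"
        using h.hom_closed[OF ac] h.S.one_closed by algebra
      ultimately show "\<one>\<^bsub>Q\<^esub> \<in> K <+>\<^bsub>Q\<^esub> D" using h.S.set_addI[OF K(2)] by blast
    qed
    have "L = K" if L: "L \<in> F" "K \<subseteq> L" for L
    proof -
      have "L \<inter> D = {\<zero>\<^bsub>Q\<^esub>}" using int L K(2) by blast
      then show ?thesis
        using h.S.right_ideal_eq_of_complement[OF Kr F[OF L(1)] D L(2) sum] by simp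
    qed
    moreover have "h.S.complement_right_ideal K D"
      unfolding h.S.complement_right_ideal_def using D sum int[OF K] by simp
    ultimately show ?thesis using K(1) by blast
  qed
  have complement: "\<exists>D. h.S.complement_right_ideal K D" if "right_ideal K Q" for K
    using key[of "{K}"] that by blast
  have maximal: "\<exists>K\<in>F. \<forall>L\<in>F. K \<subseteq> L \<longrightarrow> L = K"
    if "F \<noteq> {}" "\<And>K. K \<in> F \<Longrightarrow> right_ideal K Q" for F
    using key[OF that] by blast
  show ?thesis
    unfolding semilocal_ring_def
    using ring_axioms h.S.semisimple_of_complements[OF complement maximal]
      h.S.artinian_of_complements[OF complement maximal]
    unfolding Q_def by blast
qed

end


lemma (in ring_hom_ring) hom_Units:
  assumes "u \<in> Units R"
  shows "h u \<in> Units S"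
proof -
  have c: "u \<in> carrier R" "inv u \<in> carrier R"
    using assms R.Units_closed R.Units_inv_closed by simp_all
  have "h u \<otimes>\<^bsub>S\<^esub> h (inv u) = \<one>\<^bsub>S\<^esub>" "h (inv u) \<otimes>\<^bsub>S\<^esub> h u = \<one>\<^bsub>S\<^esub>"
    using hom_mult[OF c] hom_mult[OF c(2,1)] R.Units_r_inv[OF assms] R.Units_l_inv[OF assms]
    by simp_all
  then show ?thesis
    unfolding Units_def using c by (intro CollectI conjI bexI[of _ "h (inv u)"]) simp_all
qed

text \<open>
  If \<open>u = 1 - ba\<close> is not a unit, one of its images is not. Either the rank of the first image of
  \<open>au\<close> drops, or it is unchanged and the rank of the second one drops.
\<close>

lemma semilocal_of_unit_reflecting_homs:
  assumes f: "ring_hom_ring S S\<^sub>0 f" and g: "ring_hom_ring S S\<^sub>1 g"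
    and semilocal: "semilocal_ring S\<^sub>0" "semilocal_ring S\<^sub>1"
    and reflect: "\<And>u. u \<in> carrier S \<Longrightarrow> f u \<in> Units S\<^sub>0 \<Longrightarrow> g u \<in> Units S\<^sub>1 \<Longrightarrow> u \<in> Units S"
  shows "semilocal_ring S"
proof -
  interpret f: ring_hom_ring S S\<^sub>0 f by (rule f)
  interpret g: ring_hom_ring S S\<^sub>1 g by (rule g)
  obtain p :: "'c \<Rightarrow> 'c set set" and r where p: "unit_rank S\<^sub>0 p r"
    using f.S.unit_rank_of_semilocal[OF semilocal(1)] by blast
  obtain q :: "'e \<Rightarrow> 'e set set" and s where q: "unit_rank S\<^sub>1 q s"
    using g.S.unit_rank_of_semilocal[OF semilocal(2)] by blast
  have "unit_rank S (\<lambda>a. (p (f a), q (g a))) (r <*lex*> s)"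
    unfolding unit_rank_def Let_def
  proof (intro conjI ballI)
    show "wf (r <*lex*> s)" using unit_rank_wf[OF p] unit_rank_wf[OF q] by (rule wf_lex_prod)
    fix a b assume a: "a \<in> carrier S" and b: "b \<in> carrier S"
    let ?u = "\<one>\<^bsub>S\<^esub> \<ominus>\<^bsub>S\<^esub> b \<otimes>\<^bsub>S\<^esub> a"
    have u: "?u \<in> carrier S" using a b by simp
    have fu: "f ?u = \<one>\<^bsub>S\<^sub>0\<^esub> \<ominus>\<^bsub>S\<^sub>0\<^esub> f b \<otimes>\<^bsub>S\<^sub>0\<^esub> f a" and gu: "g ?u = \<one>\<^bsub>S\<^sub>1\<^esub> \<ominus>\<^bsub>S\<^sub>1\<^esub> g b \<otimes>\<^bsub>S\<^sub>1\<^esub> g a"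
      using a b by (simp_all add: a_minus_def)
    have fau: "f (a \<otimes>\<^bsub>S\<^esub> ?u) = f a \<otimes>\<^bsub>S\<^sub>0\<^esub> f ?u" and gau: "g (a \<otimes>\<^bsub>S\<^esub> ?u) = g a \<otimes>\<^bsub>S\<^sub>1\<^esub> g ?u"
      using a u by simp_all
    note P = unit_rank_unit[OF p f.hom_closed[OF a] f.hom_closed[OF b], folded fu, folded fau]
      unit_rank_nonunit[OF p f.hom_closed[OF a] f.hom_closed[OF b], folded fu, folded fau]
    note Q = unit_rank_unit[OF q g.hom_closed[OF a] g.hom_closed[OF b], folded gu, folded gau]
      unit_rank_nonunit[OF q g.hom_closed[OF a] g.hom_closed[OF b], folded gu, folded gau]
    show "if ?u \<in> Units S
        then (p (f (a \<otimes>\<^bsub>S\<^esub> ?u)), q (g (a \<otimes>\<^bsub>S\<^esub> ?u))) = (p (f a), q (g a))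
        else ((p (f (a \<otimes>\<^bsub>S\<^esub> ?u)), q (g (a \<otimes>\<^bsub>S\<^esub> ?u))), p (f a), q (g a)) \<in> r <*lex*> s"
    proof (cases "?u \<in> Units S")
      case True
      then show ?thesis using P(1) Q(1) f.hom_Units g.hom_Units by simp
    next
      case False
      have "((p (f (a \<otimes>\<^bsub>S\<^esub> ?u)), q (g (a \<otimes>\<^bsub>S\<^esub> ?u))), p (f a), q (g a)) \<in> r <*lex*> s"
      proof (cases "f ?u \<in> Units S\<^sub>0")
        case True
        then have "g ?u \<notin> Units S\<^sub>1" using False reflect[OF u] by blast
        then show ?thesis using P(1)[OF True] Q(2) by (simp only: in_lex_prod simp_thms)
      next
        case False
        then show ?thesis using P(2) by (simp only: in_lex_prod simp_thms)
      qed
      then show ?thesis using False by (simp only: if_False)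
    qed
  qed
  then show ?thesis by (rule f.R.semilocal_of_unit_rank)
qed


section \<open>Endomorphisms of a module homomorphism\<close>

lemma morph_End_carrier: "carrier (morph_End R M) = morph_hom R M M"
  by (simp add: morph_End_def)

lemma morph_End_ops:
  shows morph_End_mult: "u \<otimes>\<^bsub>morph_End R M\<^esub> v =
      (fst u \<otimes>\<^bsub>rmod_End R (src M)\<^esub> fst v, snd u \<otimes>\<^bsub>rmod_End R (tgt M)\<^esub> snd v)"
    and morph_End_add: "u \<oplus>\<^bsub>morph_End R M\<^esub> v =
      (fst u \<oplus>\<^bsub>rmod_End R (src M)\<^esub> fst v, snd u \<oplus>\<^bsub>rmod_End R (tgt M)\<^esub> snd v)"
    and morph_End_one: "\<one>\<^bsub>morph_End R M\<^esub> = (\<one>\<^bsub>rmod_End R (src M)\<^esub>, \<one>\<^bsub>rmod_End R (tgt M)\<^esub>)"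
  by (simp_all add: morph_End_def RDirProd_def DirProd_def monoid.defs split_def)

lemma rmod_End_simps:
  shows "carrier (rmod_End R M) = rmod_hom R M M"
    and "x \<in> carrier M \<Longrightarrow> (u \<otimes>\<^bsub>rmod_End R M\<^esub> v) x = u (v x)"
    and "x \<in> carrier M \<Longrightarrow> (u \<oplus>\<^bsub>rmod_End R M\<^esub> v) x = u x \<oplus>\<^bsub>M\<^esub> v x"
    and "x \<in> carrier M \<Longrightarrow> \<one>\<^bsub>rmod_End R M\<^esub> x = x"
    and "x \<in> carrier M \<Longrightarrow> \<zero>\<^bsub>rmod_End R M\<^esub> x = \<zero>\<^bsub>M\<^esub>"
  by (simp_all add: rmod_End_def compose_def)

lemma rmod_homD:
  assumes "f \<in> rmod_hom R M N"
  shows rmod_hom_closed: "x \<in> carrier M \<Longrightarrow> f x \<in> carrier N"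
    and rmod_hom_add: "x \<in> carrier M \<Longrightarrow> y \<in> carrier M \<Longrightarrow> f (x \<oplus>\<^bsub>M\<^esub> y) = f x \<oplus>\<^bsub>N\<^esub> f y"
  using assms by (auto simp: rmod_hom_def)

lemma rmod_hom_minus:
  assumes "abelian_group M" "abelian_group N" and f: "f \<in> rmod_hom R M N" and x: "x \<in> carrier M"
  shows "f (\<ominus>\<^bsub>M\<^esub> x) = \<ominus>\<^bsub>N\<^esub> f x"
proof -
  interpret M: abelian_group M by fact
  interpret N: abelian_group N by fact
  have "abelian_group_hom M N f"
    by (rule abelian_group_homI)
       (use f in \<open>auto simp: group_hom_def group_hom_axioms_def hom_def M.a_group N.a_group
          rmod_homD[OF f] assms(1,2)\<close>)
  then show ?thesis using x by (rule abelian_group_hom.hom_a_inv)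
qed

text \<open>
  Negation in a ring is determined by its addition, so that it suffices to evaluate
  \<open>- u + u = 0\<close> at \<open>x\<close>.
\<close>

lemma rmod_End_minus:
  assumes "ring (rmod_End R M)" "abelian_group M"
    and u: "u \<in> carrier (rmod_End R M)" and x: "x \<in> carrier M"
  shows "(\<ominus>\<^bsub>rmod_End R M\<^esub> u) x = \<ominus>\<^bsub>M\<^esub> u x"
proof -
  interpret E: ring "rmod_End R M" by fact
  interpret M: abelian_group M by fact
  let ?v = "\<ominus>\<^bsub>rmod_End R M\<^esub> u"
  have c: "u x \<in> carrier M" "?v x \<in> carrier M"
    using u E.a_inv_closed[OF u] x by (auto simp: rmod_End_simps(1) intro: rmod_hom_closed)
  have "(?v \<oplus>\<^bsub>rmod_End R M\<^esub> u) x = \<zero>\<^bsub>M\<^esub>"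
    using E.l_neg[OF u] rmod_End_simps(5)[OF x] by metis
  then have "?v x \<oplus>\<^bsub>M\<^esub> u x = \<zero>\<^bsub>M\<^esub>" using x by (simp add: rmod_End_simps)
  then show ?thesis using M.minus_equality c by simp
qed

lemma morph_hom_iff:
  assumes "arr M \<in> rmod_hom R (src M) (tgt M)"
  shows "u \<in> morph_hom R M M \<longleftrightarrow>
    fst u \<in> carrier (rmod_End R (src M)) \<and> snd u \<in> carrier (rmod_End R (tgt M)) \<and>
    (\<forall>x\<in>carrier (src M). snd u (arr M x) = arr M (fst u x))"
  by (auto simp: morph_hom_def rmod_End_simps compose_def split_def fun_eq_iff restrict_def)

context
  fixes R :: "('a, 'r) ring_scheme" and M :: "('a, 'b, 'c) morph"
  assumes M: "morph_obj R M"
    and ring0: "ring (rmod_End R (src M))" and ring1: "ring (rmod_End R (tgt M))"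
begin

lemma arr_hom: "arr M \<in> rmod_hom R (src M) (tgt M)"
  using M by (simp add: morph_obj_def)

lemma ring_morph_End: "ring (morph_End R M)"
proof -
  let ?E0 = "rmod_End R (src M)" and ?E1 = "rmod_End R (tgt M)"
  let ?P = "RDirProd ?E0 ?E1"
  interpret E0: ring ?E0 by (rule ring0)
  interpret E1: ring ?E1 by (rule ring1)
  interpret P: ring ?P by (rule RDirProd_ring[OF ring0 ring1])
  have ab: "abelian_group (src M)" "abelian_group (tgt M)"
    using M by (auto simp: morph_obj_def right_module_def)
  note iff = morph_hom_iff[OF arr_hom] and mu = rmod_homD[OF arr_hom]
  have carr: "fst u x \<in> carrier (src M)" if "u \<in> morph_hom R M M" "x \<in> carrier (src M)" for u x
    using that iff by (auto simp: rmod_End_simps(1) intro: rmod_hom_closed)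
  have ops: "u \<otimes>\<^bsub>?P\<^esub> v = (fst u \<otimes>\<^bsub>?E0\<^esub> fst v, snd u \<otimes>\<^bsub>?E1\<^esub> snd v)"
    "u \<oplus>\<^bsub>?P\<^esub> v = (fst u \<oplus>\<^bsub>?E0\<^esub> fst v, snd u \<oplus>\<^bsub>?E1\<^esub> snd v)"
    "\<one>\<^bsub>?P\<^esub> = (\<one>\<^bsub>?E0\<^esub>, \<one>\<^bsub>?E1\<^esub>)" "\<zero>\<^bsub>?P\<^esub> = (\<zero>\<^bsub>?E0\<^esub>, \<zero>\<^bsub>?E1\<^esub>)" for u v
    by (simp_all add: RDirProd_def DirProd_def monoid.defs split_def)
  have neg: "\<ominus>\<^bsub>?P\<^esub> u = (\<ominus>\<^bsub>?E0\<^esub> fst u, \<ominus>\<^bsub>?E1\<^esub> snd u)" if "u \<in> carrier ?P" for u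
    by (rule P.minus_equality)
       (use that in \<open>auto simp: ops RDirProd_carrier E0.l_neg E1.l_neg\<close>)
  have "subring (morph_hom R M M) ?P"
  proof (rule P.subringI)
    show "morph_hom R M M \<subseteq> carrier ?P"
      by (auto simp: RDirProd_carrier iff)
    show "\<one>\<^bsub>?P\<^esub> \<in> morph_hom R M M"
      by (simp add: iff ops rmod_End_simps(4) mu)
  next
    fix u assume u: "u \<in> morph_hom R M M"
    then have u': "fst u \<in> carrier ?E0" "snd u \<in> carrier ?E1"
      "\<And>x. x \<in> carrier (src M) \<Longrightarrow> snd u (arr M x) = arr M (fst u x)"
      unfolding iff by auto
    have "(\<ominus>\<^bsub>?E1\<^esub> snd u) (arr M x) = arr M ((\<ominus>\<^bsub>?E0\<^esub> fst u) x)" if x: "x \<in> carrier (src M)" for x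
      using rmod_End_minus[OF ring0 ab(1) u'(1) x] rmod_End_minus[OF ring1 ab(2) u'(2) mu(1)[OF x]]
        rmod_hom_minus[OF ab arr_hom carr[OF u x]] u'(3)[OF x] by simp
    moreover have "\<ominus>\<^bsub>?P\<^esub> u = (\<ominus>\<^bsub>?E0\<^esub> fst u, \<ominus>\<^bsub>?E1\<^esub> snd u)"
      using u' by (intro neg) (auto simp: RDirProd_carrier mem_Times_iff)
    ultimately show "\<ominus>\<^bsub>?P\<^esub> u \<in> morph_hom R M M" using u' by (simp add: iff)
  next
    fix u v assume u: "u \<in> morph_hom R M M" and v: "v \<in> morph_hom R M M"
    show "u \<otimes>\<^bsub>?P\<^esub> v \<in> morph_hom R M M" "u \<oplus>\<^bsub>?P\<^esub> v \<in> morph_hom R M M"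
      using u v carr by (auto simp: iff ops rmod_End_simps(2,3) mu)
  qed
  then show ?thesis using P.subring_is_ring by (simp add: morph_End_def)
qed

lemma morph_End_fst: "ring_hom_ring (morph_End R M) (rmod_End R (src M)) fst"
  by (rule ring_hom_ringI2[OF ring_morph_End ring0], rule ring_hom_memI)
     (auto simp: morph_End_carrier morph_End_ops morph_hom_iff[OF arr_hom])

lemma morph_End_snd: "ring_hom_ring (morph_End R M) (rmod_End R (tgt M)) snd"
  by (rule ring_hom_ringI2[OF ring_morph_End ring1], rule ring_hom_memI)
     (auto simp: morph_End_carrier morph_End_ops morph_hom_iff[OF arr_hom])

text \<open>
  The componentwise inverse commutes with the arrow \<open>\<mu>\<close>:
  \<open>u\<^sub>1\<^sup>-\<^sup>1 \<mu> = u\<^sub>1\<^sup>-\<^sup>1 \<mu> u\<^sub>0 u\<^sub>0\<^sup>-\<^sup>1 = u\<^sub>1\<^sup>-\<^sup>1 u\<^sub>1 \<mu> u\<^sub>0\<^sup>-\<^sup>1 = \<mu> u\<^sub>0\<^sup>-\<^sup>1\<close>.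
\<close>

lemma morph_End_unit:
  assumes u: "u \<in> carrier (morph_End R M)"
    and u0: "fst u \<in> Units (rmod_End R (src M))" and u1: "snd u \<in> Units (rmod_End R (tgt M))"
  shows "u \<in> Units (morph_End R M)"
proof -
  let ?E0 = "rmod_End R (src M)" and ?E1 = "rmod_End R (tgt M)"
  interpret E0: ring ?E0 by (rule ring0)
  interpret E1: ring ?E1 by (rule ring1)
  note iff = morph_hom_iff[OF arr_hom] and mu = rmod_homD[OF arr_hom]
  define v0 v1 where "v0 = inv\<^bsub>?E0\<^esub> fst u" and "v1 = inv\<^bsub>?E1\<^esub> snd u"
  have v: "v0 \<in> carrier ?E0" "v1 \<in> carrier ?E1" using u0 u1 by (simp_all add: v0_def v1_def)
  have uv: "fst u \<otimes>\<^bsub>?E0\<^esub> v0 = \<one>\<^bsub>?E0\<^esub>" "v0 \<otimes>\<^bsub>?E0\<^esub> fst u = \<one>\<^bsub>?E0\<^esub>"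
    "snd u \<otimes>\<^bsub>?E1\<^esub> v1 = \<one>\<^bsub>?E1\<^esub>" "v1 \<otimes>\<^bsub>?E1\<^esub> snd u = \<one>\<^bsub>?E1\<^esub>"
    using u0 u1 by (simp_all add: v0_def v1_def)
  have "v1 (arr M x) = arr M (v0 x)" if x: "x \<in> carrier (src M)" for x
  proof -
    have v0x: "v0 x \<in> carrier (src M)" using v(1) x by (simp add: rmod_End_simps(1) rmod_hom_closed)
    have "x = fst u (v0 x)"
      using rmod_End_simps(2,4)[OF x] uv(1) by metis
    then have "v1 (arr M x) = v1 (arr M (fst u (v0 x)))" by simp
    also have "\<dots> = v1 (snd u (arr M (v0 x)))"
      using u v0x by (simp add: morph_End_carrier iff)
    also have "\<dots> = arr M (v0 x)"
      using rmod_End_simps(2,4)[OF mu(1)[OF v0x]] uv(4) by metis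
    finally show ?thesis .
  qed
  then have vm: "(v0, v1) \<in> carrier (morph_End R M)" using v by (simp add: morph_End_carrier iff)
  show ?thesis
    unfolding Units_def using u vm
    by (intro CollectI conjI bexI[of _ "(v0, v1)"]) (simp_all add: morph_End_ops uv)
qed

end

theorem proposition4p2:
  fixes R :: "('a, 'r) ring_scheme" and M :: "('a, 'b, 'c) morph"
  assumes "ring R" and "\<one>\<^bsub>R\<^esub> \<noteq> \<zero>\<^bsub>R\<^esub>"
    and "morph_obj R M"
    and "semilocal_ring (rmod_End R (src M))"
    and "semilocal_ring (rmod_End R (tgt M))"
  shows "semilocal_ring (morph_End R M)"
proof -
  have rings: "ring (rmod_End R (src M))" "ring (rmod_End R (tgt M))"
    using assms(4,5) by (simp_all add: semilocal_ring_def)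
  show ?thesis
    by (rule semilocal_of_unit_reflecting_homs[OF morph_End_fst[OF assms(3) rings]
          morph_End_snd[OF assms(3) rings] assms(4,5) morph_End_unit[OF assms(3) rings]])
qed

end
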